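(* Let $(\sigma,\alpha)$ be a collection of hypermaps on the set $\{1,\ldots,n\}$, and let $Q\ge0$ and $t>0$ be real parameters. Then the partition function $Z(\sigma,\alpha;Q,t)$ of the random cluster model satisfies $$Z(\sigma,\alpha;Q,t)=\frac{Q^{\kappa(\sigma,\alpha)}\,t^{\,n+\kappa(\sigma,\alpha)-z(\sigma)-z(\alpha)}}{\prod_{i=1}^n\widetilde N_i(t)^{z_i(\alpha)}}\cdot R(\sigma,\alpha;Qt,t^{-1}).$$
   Context: A collection of hypermaps is a pair $(\sigma,\alpha)$ of permutations of $\{1,\ldots,n\}$; $\kappa(\sigma,\alpha)$ is the number of orbits of $\langle\sigma,\alpha\rangle$. $z(\pi)$ is the number of cycles of $\pi$ (fixed points included) and $z_i(\pi)$ the number of its cycles of length $i$. A permutation $\beta$ refines $\alpha$, written $\beta\le\alpha$, if for each cycle $\gamma$ of $\alpha$, $\beta$ maps the set of points of $\gamma$ to itself and its restriction $\theta$ to this set of $m$ points satisfies $m+2=z(\theta)+z(\gamma)+z(\gamma^{-1}\theta)$; equivalently the cycles of $\theta$ form a noncrossing partition with respect to the cyclic order $\gamma$, each listing its points in the cyclic order induced by $\gamma$. The Whitney polynomial is $R(\sigma,\alpha;u,v)=\sum_{\beta\le\alpha}u^{\kappa(\sigma,\beta)-\kappa(\sigma,\alpha)}v^{\kappa(\sigma,\beta)+n-z(\beta)-z(\sigma)}$ (with $0^0=1$ upon substitution). Let $N(m,k)=\frac1m\binom mk\binom m{k-1}$ be the Narayana numbers and $\widetilde N_m(t)=\sum_{k=1}^mN(m,k)t^{k-1}$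 for $m\ge1$. In the random cluster model the probability of a refinement $\beta$ of $\alpha$ is $\mu(\beta)=Z^{-1}Q^{\kappa(\sigma,\beta)}\,t^{z(\beta)-z(\alpha)}/\prod_{i=1}^n\widetilde N_i(t)^{z_i(\alpha)}$, where the partition function $Z$ is the normalizing factor $$Z(\sigma,\alpha;Q,t)=\sum_{\beta\le\alpha}Q^{\kappa(\sigma,\beta)}\frac{t^{z(\beta)-z(\alpha)}}{\prod_{i=1}^n\widetilde N_i(t)^{z_i(\alpha)}}.$$ *)

theory Defs
  imports
    Complex_Main
    "HOL-Combinatorics.Orbits"
    "HOL-Algebra.Sym_Groups"
    "HOL-Algebra.Group_Action"
begin

definition hypermap_collection :: "nat \<Rightarrow> (nat \<Rightarrow> nat) \<Rightarrow> (nat \<Rightarrow> nat) \<Rightarrow> bool" where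
  "hypermap_collection n \<sigma> \<alpha> \<longleftrightarrow> \<sigma> permutes {1..n} \<and> \<alpha> permutes {1..n}"

(* The permutations used here fix every point outside their domain S, so S is passed
   explicitly: a fixed point in S is a cycle of length 1, a point outside S is not counted. *)
definition cycles_of :: "'a set \<Rightarrow> ('a \<Rightarrow> 'a) \<Rightarrow> 'a set set" where
  "cycles_of S \<pi> = Orbits.orbit \<pi> ` S"

definition num_cycles :: "'a set \<Rightarrow> ('a \<Rightarrow> 'a) \<Rightarrow> nat" where
  "num_cycles S \<pi> = card (cycles_of S \<pi>)"

definition num_cycles_len :: "nat \<Rightarrow> 'a set \<Rightarrow> ('a \<Rightarrow> 'a) \<Rightarrow> nat" where
  "num_cycles_len i S \<pi> = card {C \<in> cycles_of S \<pi>. card C = i}"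

definition \<kappa> :: "nat \<Rightarrow> (nat \<Rightarrow> nat) \<Rightarrow> (nat \<Rightarrow> nat) \<Rightarrow> nat" where
  "\<kappa> n \<sigma> \<alpha> =
     card (Group_Action.orbits
       (sym_group n \<lparr> carrier := generate (sym_group n) {\<sigma>, \<alpha>} \<rparr>) {1..n} (\<lambda>g. g))"

(* A cycle of alpha is represented by its set of points C; the cyclic permutation itself is
   perm_restrict alpha C.  The order of composition is immaterial, since
   inv gamma o theta and theta o inv gamma are conjugate by a permutation of C. *)
definition refines :: "nat \<Rightarrow> (nat \<Rightarrow> nat) \<Rightarrow> (nat \<Rightarrow> nat) \<Rightarrow> bool" where
  "refines n \<beta> \<alpha> \<longleftrightarrow>
     \<beta> permutes {1..n} \<and>
     (\<forall>C \<in> cycles_of {1..n} \<alpha>.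
        \<beta> ` C = C \<and>
        (let \<gamma> = perm_restrict \<alpha> C; \<theta> = perm_restrict \<beta> C in
           card C + 2 = num_cycles C \<theta> + num_cycles C \<gamma> + num_cycles C (inv' \<gamma> \<circ> \<theta>)))"

(* The exponents are formed over the integers, avoiding truncated subtraction;
   0 powi 0 = 1 holds. *)
definition whitney_R ::
  "nat \<Rightarrow> (nat \<Rightarrow> nat) \<Rightarrow> (nat \<Rightarrow> nat) \<Rightarrow> real \<Rightarrow> real \<Rightarrow> real" where
  "whitney_R n \<sigma> \<alpha> u v =
     (\<Sum>\<beta> | refines n \<beta> \<alpha>.
        u powi (int (\<kappa> n \<sigma> \<beta>) - int (\<kappa> n \<sigma> \<alpha>)) *
        v powi (int (\<kappa> n \<sigma> \<beta>) + int n - int (num_cycles {1..n} \<beta>) - int (num_cycles {1..n} \<sigma>)))"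

definition narayana :: "nat \<Rightarrow> nat \<Rightarrow> real" where
  "narayana m k = 1 / real m * real (m choose k) * real (m choose (k - 1))"

definition narayana_poly :: "nat \<Rightarrow> real \<Rightarrow> real" where
  "narayana_poly m t = (\<Sum>k = 1..m. narayana m k * t ^ (k - 1))"

definition rcm_weight ::
  "nat \<Rightarrow> (nat \<Rightarrow> nat) \<Rightarrow> (nat \<Rightarrow> nat) \<Rightarrow> real \<Rightarrow> real \<Rightarrow> (nat \<Rightarrow> nat) \<Rightarrow> real" where
  "rcm_weight n \<sigma> \<alpha> Q t \<beta> =
     Q ^ \<kappa> n \<sigma> \<beta> *
     (t powi (int (num_cycles {1..n} \<beta>) - int (num_cycles {1..n} \<alpha>)) /
      (\<Prod>i = 1..n. narayana_poly i t ^ num_cycles_len i {1..n} \<alpha>))"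

definition partition_Z ::
  "nat \<Rightarrow> (nat \<Rightarrow> nat) \<Rightarrow> (nat \<Rightarrow> nat) \<Rightarrow> real \<Rightarrow> real \<Rightarrow> real" where
  "partition_Z n \<sigma> \<alpha> Q t = (\<Sum>\<beta> | refines n \<beta> \<alpha>. rcm_weight n \<sigma> \<alpha> Q t \<beta>)"

end

theory Submission
  imports Defs
begin

text \<open>Both sides are sums over the refinements of \<alpha> and agree term by term. For Q = 0 the
  exponents of Q need not be compared: the number of orbits vanishes only for n = 0, so for
  n > 0 both sides carry a positive power of 0.\<close>

text \<open>The set of orbits is the image of the finite set \<open>{1..n}\<close> under the map
  sending a point to its orbit.\<close>

lemma kappa_eq_0_iff: "\<kappa> n \<sigma> \<alpha> = 0 \<longleftrightarrow> n = 0"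
proof -
  have "\<kappa> n \<sigma> \<alpha> = 0 \<longleftrightarrow> {1..n} = {}"
    unfolding \<kappa>_def Group_Action.orbits_def setcompr_eq_image Collect_mem_eq
    by (simp only: card_eq_0_iff image_is_empty finite_imageI finite_atLeastAtMost simp_thms)
  then show ?thesis by auto
qed

text \<open>At \<open>x = 0\<close> the hypothesis leaves two cases: both exponents are 0 and both
  sides are 1, or both are positive and both sides are 0, whatever the middle factor.\<close>

lemma power_times_powi_diff:
  fixes x :: "'a :: field"
  assumes "a = 0 \<longleftrightarrow> b = 0"
  shows "x ^ a * x powi (int b - int a) = x ^ b"
  using assms by (cases "x = 0") (auto simp: power_int_diff power_0_left)

lemma rcm_weight_eq_whitney_term:
  fixes Q t :: real
  assumes "t > 0"
  shows "rcm_weight n \<sigma> \<alpha> Q t \<beta> =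
    Q ^ \<kappa> n \<sigma> \<alpha> *
      t powi (int n + int (\<kappa> n \<sigma> \<alpha>) - int (num_cycles {1..n} \<sigma>) - int (num_cycles {1..n} \<alpha>)) /
      (\<Prod>i = 1..n. narayana_poly i t ^ num_cycles_len i {1..n} \<alpha>) *
    ((Q * t) powi (int (\<kappa> n \<sigma> \<beta>) - int (\<kappa> n \<sigma> \<alpha>)) *
     inverse t powi (int (\<kappa> n \<sigma> \<beta>) + int n - int (num_cycles {1..n} \<beta>) - int (num_cycles {1..n} \<sigma>)))"
    (is "_ = ?Qa * t powi ?e / ?P * ((Q * t) powi ?d * inverse t powi ?f)")
proof -
  \<comment> \<open>Inverting t negates \<open>?f\<close>; in \<open>?e + ?d - ?f\<close> the terms
    n, z(\<sigma>) and both \<kappa> values cancel.\<close>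
  have t_powers: "t powi ?e * (t powi ?d * inverse t powi ?f) =
      t powi (int (num_cycles {1..n} \<beta>) - int (num_cycles {1..n} \<alpha>))"
    using assms by (simp add: power_int_inverse flip: power_int_minus power_int_add)
  have Q_powers: "?Qa * Q powi ?d = Q ^ \<kappa> n \<sigma> \<beta>"
    by (rule power_times_powi_diff) (simp add: kappa_eq_0_iff)
  show ?thesis
    \<comment> \<open>Read from right to left, the two identities expand the weight; once
      \<open>(Q * t) powi ?d\<close> is split, both sides have the same factors up to order.\<close>
    unfolding rcm_weight_def Q_powers[symmetric] t_powers[symmetric] power_int_mult_distrib
    by simp
qed

theorem mainTheorem5:
  fixes n :: nat and \<sigma> \<alpha> :: "nat \<Rightarrow> nat" and Q t :: real
  assumes "hypermap_collection n \<sigma> \<alpha>"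
    and "Q \<ge> 0" and "t > 0"
  shows "partition_Z n \<sigma> \<alpha> Q t =
    Q ^ \<kappa> n \<sigma> \<alpha> *
      t powi (int n + int (\<kappa> n \<sigma> \<alpha>) - int (num_cycles {1..n} \<sigma>) - int (num_cycles {1..n} \<alpha>)) /
      (\<Prod>i = 1..n. narayana_poly i t ^ num_cycles_len i {1..n} \<alpha>) *
    whitney_R n \<sigma> \<alpha> (Q * t) (inverse t)"
  unfolding partition_Z_def whitney_R_def sum_distrib_left
  by (rule sum.cong[OF refl], rule rcm_weight_eq_whitney_term[OF \<open>t > 0\<close>])

end
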